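(* Let $R$ be a ring and let $\mathcal{F}$ be a right Oka family of right ideals of $R$ such that every nonempty chain of right ideals in $\mathcal{F}'$ (with respect to inclusion) has an upper bound in $\mathcal{F}'$. Let $\mathcal{S}$ be a set of right ideals of $R$ that is a point annihilator set for the class of modules $\{R/I : I \in \mathrm{Max}(\mathcal{F}')\}$. (1) Let $\mathcal{F}_0$ be a divisible semifilter of right ideals in $R$. If $\mathcal{F}_0 \cap \mathcal{S} \subseteq \mathcal{F}$, then $\mathcal{F}_0 \subseteq \mathcal{F}$. (2) For any two-sided ideal $J$ of $R$, if all right ideals in $\mathcal{S}$ that contain $J$ belong to $\mathcal{F}$, then every right ideal containing $J$ belongs to $\mathcal{F}$. (3) If $\mathcal{S} \subseteq \mathcal{F}$, then all right ideals of $R$ belong to $\mathcal{F}$.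
   Context: Rings are associative with identity; modules are unital right modules. For a right ideal $I$ of $R$ and $a \in R$, $a^{-1}I := \{r \in R : ar \in I\}$. A family $\mathcal{F}$ of right ideals of $R$ is a right Oka family if $R \in \mathcal{F}$ and, for every $a \in R$ and every right ideal $I$ of $R$, $I + aR \in \mathcal{F}$ and $a^{-1}I \in \mathcal{F}$ imply $I \in \mathcal{F}$. For a family $\mathcal{F}$ of right ideals, $\mathcal{F}'$ denotes the set of right ideals of $R$ not in $\mathcal{F}$, and $\mathrm{Max}(\mathcal{F}')$ the set of right ideals that are maximal (under inclusion) in $\mathcal{F}'$. A semifilter is a family $\mathcal{F}_0$ of right ideals such that $J \in \mathcal{F}_0$ and $J \subseteq I$ ($I$ a right ideal) imply $I \in \mathcal{F}_0$; a family $\mathcal{F}_0$ is divisible if $I \in \mathcal{F}_0$ and $a \in R$ imply $a^{-1}I \in \mathcal{F}_0$. A point annihilator of a right module $M$ is the annihilator $\mathrm{ann}(m)=\{r\in R: mr=0\}$ of some nonzero $m \in M$. A set $\mathcal{S}$ of right ideals of $R$ is a point annihilator set for a class $\mathcal{C}$ of right $R$-modules if every nonzero $M \in \mathcal{C}$ has a point annihilator lying in $\mathcal{S}$ (members of $\mathcal{S}$ are not required to be point annihilators of modules in $\mathcal{C}$). *)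

theory Defs
  imports "HOL-Algebra.QuotRing"
begin

section \<open>Right ideals\<close>

locale right_ideal = additive_subgroup I R + ring R for I and R (structure) +
  assumes I_r_closed: "\<lbrakk>a \<in> I; x \<in> carrier R\<rbrakk> \<Longrightarrow> a \<otimes> x \<in> I"

sublocale right_ideal \<subseteq> abelian_subgroup I R
  by (rule abelian_subgroupI3) (rule is_additive_subgroup, rule is_abelian_group)

definition right_ideals :: "('a, 'm) ring_scheme \<Rightarrow> 'a set set" where
  "right_ideals R = {I. right_ideal I R}"

text \<open>The right ideal \<open>a\<^sup>-\<^sup>1 I\<close>; no inverse of \<open>a\<close> is involved.\<close>

definition right_colon :: "('a, 'm) ring_scheme \<Rightarrow> 'a \<Rightarrow> 'a set \<Rightarrow> 'a set" where
  "right_colon R a I = {r \<in> carrier R. a \<otimes>\<^bsub>R\<^esub> r \<in> I}"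


section \<open>Families of right ideals\<close>

text \<open>In \<open>right_oka_family\<close>, \<open>a <# carrier R\<close> is the principal right ideal \<open>aR\<close>.\<close>

definition right_oka_family :: "('a, 'm) ring_scheme \<Rightarrow> 'a set set \<Rightarrow> bool" where
  "right_oka_family R F \<longleftrightarrow>
     F \<subseteq> right_ideals R \<and> carrier R \<in> F \<and>
     (\<forall>a\<in>carrier R. \<forall>I\<in>right_ideals R.
        I <+>\<^bsub>R\<^esub> (a <#\<^bsub>R\<^esub> carrier R) \<in> F \<and> right_colon R a I \<in> F \<longrightarrow> I \<in> F)"

definition family_compl :: "('a, 'm) ring_scheme \<Rightarrow> 'a set set \<Rightarrow> 'a set set" where
  "family_compl R F = right_ideals R - F"

definition maximal_members :: "'a set set \<Rightarrow> 'a set set" where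
  "maximal_members G = {I \<in> G. \<forall>J\<in>G. I \<subseteq> J \<longrightarrow> J = I}"

definition semifilter :: "('a, 'm) ring_scheme \<Rightarrow> 'a set set \<Rightarrow> bool" where
  "semifilter R F \<longleftrightarrow>
     F \<subseteq> right_ideals R \<and> (\<forall>J\<in>F. \<forall>I\<in>right_ideals R. J \<subseteq> I \<longrightarrow> I \<in> F)"

definition divisible_family :: "('a, 'm) ring_scheme \<Rightarrow> 'a set set \<Rightarrow> bool" where
  "divisible_family R F \<longleftrightarrow>
     F \<subseteq> right_ideals R \<and> (\<forall>I\<in>F. \<forall>a\<in>carrier R. right_colon R a I \<in> F)"


section \<open>Right modules and point annihilators\<close>

text \<open>As for the library's modules, the additive group is carried by the \<open>ring\<close> record, whose
  multiplicative fields play no role.\<close>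

record ('a, 'b) right_module = "'b ring" +
  ract :: "['b, 'a] \<Rightarrow> 'b" (infixl \<open>\<triangleleft>\<index>\<close> 70)

locale right_module = R?: ring R + M?: abelian_group M
  for R (structure) and M :: "('a, 'b, 'n) right_module_scheme" (structure) +
  assumes ract_closed: "\<lbrakk>m \<in> carrier M; r \<in> carrier R\<rbrakk> \<Longrightarrow> m \<triangleleft>\<^bsub>M\<^esub> r \<in> carrier M"
    and ract_l_distr: "\<lbrakk>m \<in> carrier M; n \<in> carrier M; r \<in> carrier R\<rbrakk> \<Longrightarrow>
      (m \<oplus>\<^bsub>M\<^esub> n) \<triangleleft>\<^bsub>M\<^esub> r = (m \<triangleleft>\<^bsub>M\<^esub> r) \<oplus>\<^bsub>M\<^esub> (n \<triangleleft>\<^bsub>M\<^esub> r)"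
    and ract_r_distr: "\<lbrakk>m \<in> carrier M; r \<in> carrier R; s \<in> carrier R\<rbrakk> \<Longrightarrow>
      m \<triangleleft>\<^bsub>M\<^esub> (r \<oplus>\<^bsub>R\<^esub> s) = (m \<triangleleft>\<^bsub>M\<^esub> r) \<oplus>\<^bsub>M\<^esub> (m \<triangleleft>\<^bsub>M\<^esub> s)"
    and ract_assoc: "\<lbrakk>m \<in> carrier M; r \<in> carrier R; s \<in> carrier R\<rbrakk> \<Longrightarrow>
      m \<triangleleft>\<^bsub>M\<^esub> (r \<otimes>\<^bsub>R\<^esub> s) = (m \<triangleleft>\<^bsub>M\<^esub> r) \<triangleleft>\<^bsub>M\<^esub> s"
    and ract_one: "m \<in> carrier M \<Longrightarrow> m \<triangleleft>\<^bsub>M\<^esub> \<one>\<^bsub>R\<^esub> = m"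

definition elem_annihilator ::
  "('a, 'm) ring_scheme \<Rightarrow> ('a, 'b, 'n) right_module_scheme \<Rightarrow> 'b \<Rightarrow> 'a set" where
  "elem_annihilator R M m = {r \<in> carrier R. m \<triangleleft>\<^bsub>M\<^esub> r = \<zero>\<^bsub>M\<^esub>}"

definition point_annihilators ::
  "('a, 'm) ring_scheme \<Rightarrow> ('a, 'b, 'n) right_module_scheme \<Rightarrow> 'a set set" where
  "point_annihilators R M = elem_annihilator R M ` (carrier M - {\<zero>\<^bsub>M\<^esub>})"

definition point_annihilator_set ::
  "('a, 'm) ring_scheme \<Rightarrow> ('a, 'b, 'n) right_module_scheme set \<Rightarrow> 'a set set \<Rightarrow> bool" where
  "point_annihilator_set R C S \<longleftrightarrow>
     S \<subseteq> right_ideals R \<and>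
     (\<forall>M\<in>C. carrier M \<noteq> {\<zero>\<^bsub>M\<^esub>} \<longrightarrow> point_annihilators R M \<inter> S \<noteq> {})"

text \<open>The right module \<open>R/I\<close>. The action is \<open>(I + x) r = I + x r\<close>, written as a union over
  representatives in the same way as \<^const>\<open>rcoset_mult\<close>.\<close>

definition quot_right_module :: "('a, 'm) ring_scheme \<Rightarrow> 'a set \<Rightarrow> ('a, 'a set) right_module" where
  "quot_right_module R I =
     \<lparr>carrier = a_rcosets\<^bsub>R\<^esub> I, mult = undefined, one = undefined, zero = I, add = set_add R,
      ract = (\<lambda>X r. \<Union>x\<in>X. I +>\<^bsub>R\<^esub> (x \<otimes>\<^bsub>R\<^esub> r))\<rparr>"

lemma (in right_ideal) quot_ract:
  assumes x: "x \<in> carrier R" and r: "r \<in> carrier R"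
  shows "(I +> x) \<triangleleft>\<^bsub>quot_right_module R I\<^esub> r = I +> (x \<otimes> r)"
proof -
  have "I +> (y \<otimes> r) = I +> (x \<otimes> r)" if y: "y \<in> I +> x" for y
  proof -
    from y obtain h where h: "h \<in> I" "y = h \<oplus> x"
      by (auto simp: a_r_coset_def r_coset_def)
    have "y \<otimes> r = (h \<otimes> r) \<oplus> (x \<otimes> r)"
      using h x r by (simp add: l_distr)
    moreover have "h \<otimes> r \<in> I"
      using h r by (simp add: I_r_closed)
    ultimately have "y \<otimes> r \<in> I +> (x \<otimes> r)"
      by (auto simp: a_r_coset_def r_coset_def)
    then show ?thesis
      using x r by (intro a_repr_independence'[symmetric]) simp_all
  qed
  moreover have "x \<in> I +> x"
    using x by (rule a_rcos_self)
  ultimately have "(\<Union>y\<in>I +> x. I +> (y \<otimes> r)) = I +> (x \<otimes> r)"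
    by blast
  then show ?thesis
    by (simp add: quot_right_module_def)
qed

lemma (in right_ideal) quot_right_module: "right_module R (quot_right_module R I)"
proof -
  let ?M = "quot_right_module R I"
  have M: "carrier ?M = (\<lambda>x. I +> x) ` carrier R"
    by (auto simp: quot_right_module_def A_RCOSETS_defs a_r_coset_def)
  have add: "X \<oplus>\<^bsub>?M\<^esub> Y = X <+> Y" for X Y
    by (simp add: quot_right_module_def)
  interpret Q: comm_group "R A_Mod I"
    by (rule a_factorgroup_is_comm_group)
  have Q: "carrier (R A_Mod I) = carrier ?M" "\<one>\<^bsub>R A_Mod I\<^esub> = \<zero>\<^bsub>?M\<^esub>"
    "X \<otimes>\<^bsub>R A_Mod I\<^esub> Y = X \<oplus>\<^bsub>?M\<^esub> Y" for X Y
    by (simp_all add: quot_right_module_def A_FactGroup_def')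
  have "abelian_group ?M"
    by (rule abelian_groupI)
      (fact Q.m_closed[unfolded Q] Q.one_closed[unfolded Q] Q.m_assoc[unfolded Q]
        Q.m_comm[unfolded Q] Q.l_one[unfolded Q] Q.l_inv_ex[unfolded Q])+
  then show ?thesis
    by (intro right_module.intro right_module_axioms.intro ring_axioms)
      (auto simp: M add quot_ract a_rcos_sum l_distr r_distr m_assoc)
qed

end

theory Submission
  imports Defs
begin

text \<open>A member of \<open>F\<^sub>0\<close> outside \<open>F\<close> lies below some \<open>P\<close> maximal
  outside \<open>F\<close>, by Zorn's lemma. A point annihilator of \<open>R/P\<close> lying in \<open>S\<close> is \<open>a\<^sup>-\<^sup>1 P\<close> with
  \<open>a \<notin> P\<close>; divisibility puts it into \<open>F\<^sub>0\<close> and hence into \<open>F\<close>, maximality of \<open>P\<close> puts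
  \<open>P + aR\<close> into \<open>F\<close>, and the Oka property then forces \<open>P\<close> into \<open>F\<close>, a contradiction. The other
  two parts are the case where \<open>F\<^sub>0\<close> consists of the right ideals containing a two-sided ideal.\<close>

lemma right_ideal_iff:
  fixes R (structure)
  assumes "ring R"
  shows "right_ideal I R \<longleftrightarrow>
    additive_subgroup I R \<and> (\<forall>x\<in>I. \<forall>r\<in>carrier R. x \<otimes> r \<in> I)"
  using assms by (auto simp: right_ideal_def right_ideal_axioms_def)

context ring
begin

lemma additive_subgroup_principal_right:
  assumes a: "a \<in> carrier R"
  shows "additive_subgroup (a <# carrier R) R"
proof (rule additive_subgroupI, rule add.subgroupI)
  show "a <# carrier R \<subseteq> carrier R"
    using a by (auto simp: l_coset_def)
  show "a <# carrier R \<noteq> {}"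
    by (auto simp: l_coset_def)
  show "\<ominus> x \<in> a <# carrier R" if "x \<in> a <# carrier R" for x
  proof -
    from that obtain r where "r \<in> carrier R" "x = a \<otimes> r"
      by (auto simp: l_coset_def)
    then have "\<ominus> x = a \<otimes> \<ominus> r" "\<ominus> r \<in> carrier R"
      using a by (simp_all add: r_minus)
    then show ?thesis
      by (auto simp: l_coset_def)
  qed
  show "x \<oplus> y \<in> a <# carrier R" if "x \<in> a <# carrier R" "y \<in> a <# carrier R" for x y
  proof -
    from that obtain r s where "r \<in> carrier R" "x = a \<otimes> r" "s \<in> carrier R" "y = a \<otimes> s"
      by (auto simp: l_coset_def)
    then have "x \<oplus> y = a \<otimes> (r \<oplus> s)" "r \<oplus> s \<in> carrier R"
      using a by (simp_all add: r_distr)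
    then show ?thesis
      by (auto simp: l_coset_def)
  qed
qed

lemma right_ideal_principal:
  assumes a: "a \<in> carrier R"
  shows "right_ideal (a <# carrier R) R"
  using a additive_subgroup_principal_right[OF a]
  by (auto simp: right_ideal_iff[OF ring_axioms] l_coset_def m_assoc)

lemma right_ideal_add:
  assumes I: "right_ideal I R" and J: "right_ideal J R"
  shows "right_ideal (I <+> J) R"
proof -
  interpret I: right_ideal I R by fact
  interpret J: right_ideal J R by fact
  have "x \<otimes> r \<in> I <+>\<^bsub>R\<^esub> J" if "x \<in> I <+>\<^bsub>R\<^esub> J" and r: "r \<in> carrier R" for x r
  proof -
    from that obtain i j where "i \<in> I" "j \<in> J" "x = i \<oplus> j"
      by (auto simp: set_add_def')
    then have "x \<otimes> r = i \<otimes> r \<oplus> j \<otimes> r" "i \<otimes> r \<in> I" "j \<otimes> r \<in> J"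
      using r by (simp_all add: l_distr I.I_r_closed J.I_r_closed)
    then show ?thesis
      by (auto simp: set_add_def')
  qed
  moreover have "additive_subgroup (I <+> J) R"
    by (rule add_additive_subgroups) (unfold_locales)
  ultimately show ?thesis
    by (simp add: right_ideal_iff[OF ring_axioms])
qed

lemma right_ideal_colon:
  assumes I: "right_ideal I R" and a: "a \<in> carrier R"
  shows "right_ideal (right_colon R a I) R"
proof -
  interpret I: right_ideal I R by fact
  have "additive_subgroup (right_colon R a I) R"
  proof (rule additive_subgroupI, rule add.subgroupI)
    show "right_colon R a I \<subseteq> carrier R"
      by (auto simp: right_colon_def)
    have "\<zero> \<in> right_colon R a I"
      using a by (simp add: right_colon_def)
    then show "right_colon R a I \<noteq> {}"
      by blast
  qed (use a in \<open>auto simp: right_colon_def r_minus r_distr\<close>)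
  then show ?thesis
    using a by (auto simp: right_ideal_iff[OF ring_axioms] right_colon_def I.I_r_closed
        simp flip: m_assoc)
qed

text \<open>The identity of \<open>R\<close> puts \<open>a\<close> itself into \<open>aR\<close>, so
  the sum gains an element outside \<open>I\<close>. Strictness is what lets maximality be applied
  to \<open>P + aR\<close>.\<close>

lemma psubset_add_principal:
  assumes I: "right_ideal I R" and a: "a \<in> carrier R" "a \<notin> I"
  shows "I \<subset> I <+>\<^bsub>R\<^esub> (a <# carrier R)"
proof -
  interpret I: right_ideal I R by fact
  have "x \<in> I <+>\<^bsub>R\<^esub> (a <# carrier R)" if "x \<in> I" for x
  proof -
    have "x = x \<oplus> a \<otimes> \<zero>"
      using that a by simp
    then show ?thesis
      unfolding set_add_def' l_coset_def using that by blast
  qed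
  moreover have "a = \<zero> \<oplus> a \<otimes> \<one>"
    using a by simp
  then have "a \<in> I <+>\<^bsub>R\<^esub> (a <# carrier R)"
    unfolding set_add_def' l_coset_def using I.zero_closed by blast
  ultimately show ?thesis
    using a by blast
qed

lemma coset_eq_self_iff:
  assumes I: "right_ideal I R" and x: "x \<in> carrier R"
  shows "I +> x = I \<longleftrightarrow> x \<in> I"
proof -
  interpret I: right_ideal I R by fact
  show ?thesis
    using x I.a_rcos_self I.a_rcos_const by blast
qed

lemma elem_annihilator_quot:
  assumes I: "right_ideal I R" and a: "a \<in> carrier R"
  shows "elem_annihilator R (quot_right_module R I) (I +> a) = right_colon R a I"
proof -
  have "(I +> a) \<triangleleft>\<^bsub>quot_right_module R I\<^esub> r = \<zero>\<^bsub>quot_right_module R I\<^esub> \<longleftrightarrow> a \<otimes> r \<in> I"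
    if "r \<in> carrier R" for r
    using that a coset_eq_self_iff[OF I, of "a \<otimes> r"]
    \<comment> \<open>The action is evaluated while \<open>quot_right_module\<close> is still
      folded; unfolding it first would expose the union over representatives, which
      \<open>quot_ract\<close> no longer matches.\<close>
    by (simp only: right_ideal.quot_ract[OF I] m_closed) (simp add: quot_right_module_def)
  then show ?thesis
    unfolding elem_annihilator_def right_colon_def by blast
qed

lemma quot_right_module_nonzero:
  assumes I: "right_ideal I R"
  shows "carrier (quot_right_module R I) - {\<zero>\<^bsub>quot_right_module R I\<^esub>} =
    (\<lambda>a. I +> a) ` (carrier R - I)"
proof -
  have "carrier (quot_right_module R I) = (\<lambda>a. I +> a) ` carrier R"
    by (auto simp: quot_right_module_def A_RCOSETS_defs a_r_coset_def)
  moreover have "\<zero>\<^bsub>quot_right_module R I\<^esub> = I"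
    by (simp add: quot_right_module_def)
  \<comment> \<open>Many representatives give the same coset, so the zero coset is removed by
    restricting the domain to representatives of nonzero cosets.\<close>
  moreover have "f ` A - {z} = f ` {a \<in> A. f a \<noteq> z}" for f :: "'a \<Rightarrow> 'a set" and A z
    by blast
  moreover have "{a \<in> carrier R. I +> a \<noteq> I} = carrier R - I"
    using coset_eq_self_iff[OF I] by blast
  ultimately show ?thesis
    by simp
qed

text \<open>Turns the module-theoretic hypothesis on \<open>S\<close> into one about the right
  ideals that occur in the Oka condition.\<close>

lemma point_annihilators_quot:
  assumes I: "right_ideal I R"
  shows "point_annihilators R (quot_right_module R I) =
    (\<lambda>a. right_colon R a I) ` (carrier R - I)"
  by (simp add: point_annihilators_def quot_right_module_nonzero[OF I] image_image
      elem_annihilator_quot[OF I])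

lemma oka_maximal_colon_notin:
  assumes oka: "right_oka_family R F"
    and P: "P \<in> maximal_members (family_compl R F)"
    and a: "a \<in> carrier R" "a \<notin> P"
  shows "right_colon R a P \<notin> F"
proof
  assume colon: "right_colon R a P \<in> F"
  have P': "right_ideal P R" "P \<notin> F"
    using P by (auto simp: maximal_members_def family_compl_def right_ideals_def)
  have "right_ideal (P <+> (a <# carrier R)) R"
    using P' a by (intro right_ideal_add right_ideal_principal)
  \<comment> \<open>A right ideal strictly above \<open>P\<close> cannot lie in the complement of
    \<open>F\<close>, by maximality of \<open>P\<close>.\<close>
  then have "P <+> (a <# carrier R) \<in> F"
    using P psubset_add_principal[OF P'(1) a]
    by (auto simp: maximal_members_def family_compl_def right_ideals_def)
  with oka colon P' a show False
    by (auto simp: right_oka_family_def right_ideals_def)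
qed

text \<open>Divisibility rests on closure of \<open>J\<close> under left multiplication: for
  \<open>x\<close> in \<open>J\<close>, the product \<open>a x\<close> lies in \<open>J\<close> and
  hence in \<open>I\<close>, so \<open>J\<close> is contained in
  \<open>right_colon R a I\<close>.\<close>

lemma divisible_semifilter_containing:
  assumes J: "ideal J R"
  shows "divisible_family R {I \<in> right_ideals R. J \<subseteq> I}"
    and "semifilter R {I \<in> right_ideals R. J \<subseteq> I}"
proof -
  interpret J: ideal J R by fact
  show "divisible_family R {I \<in> right_ideals R. J \<subseteq> I}"
    using J.I_l_closed J.a_subset right_ideal_colon
    by (auto simp: divisible_family_def right_ideals_def right_colon_def)
  show "semifilter R {I \<in> right_ideals R. J \<subseteq> I}"
    by (auto simp: semifilter_def)
qed

end

text \<open>Zorn's lemma is applied to the members of \<open>G\<close> above \<open>I\<close>, so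
  that the maximal element found also contains \<open>I\<close>.\<close>

lemma maximal_member_above:
  assumes chain: "\<And>C. \<lbrakk>subset.chain G C; C \<noteq> {}\<rbrakk> \<Longrightarrow> \<exists>U\<in>G. \<forall>I\<in>C. I \<subseteq> U"
    and I: "I \<in> G"
  obtains P where "P \<in> maximal_members G" "I \<subseteq> P"
proof -
  have "\<exists>P\<in>{K \<in> G. I \<subseteq> K}. \<forall>X\<in>{K \<in> G. I \<subseteq> K}. P \<subseteq> X \<longrightarrow> X = P"
  proof (rule subset_Zorn)
    fix C assume C: "subset.chain {K \<in> G. I \<subseteq> K} C"
    show "\<exists>U\<in>{K \<in> G. I \<subseteq> K}. \<forall>X\<in>C. X \<subseteq> U"
    proof (cases "C = {}")
      case True
      then show ?thesis
        \<comment> \<open>The hypothesis covers nonempty chains only; \<open>I\<close> itself bounds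
          the empty one.\<close>
        using I by blast
    next
      case False
      then obtain X where X: "X \<in> C"
        by blast
      have "subset.chain G C"
        using C by (auto simp: subset_chain_def)
      from chain[OF this False] obtain U where U: "U \<in> G" "\<forall>X\<in>C. X \<subseteq> U" ..
      \<comment> \<open>The bound \<open>U\<close> is only known to lie in \<open>G\<close>; a
        member of the nonempty chain shows that it also contains \<open>I\<close>.\<close>
      have "I \<subseteq> X"
        using C X by (auto simp: subset_chain_def)
      also have "X \<subseteq> U"
        using U X by simp
      finally show ?thesis
        using U by auto
    qed
  qed
  then obtain P where "P \<in> G" "I \<subseteq> P" "\<forall>X\<in>G. I \<subseteq> X \<longrightarrow> P \<subseteq> X \<longrightarrow> X = P"
    by auto
  \<comment> \<open>Whatever lies above \<open>P\<close> lies above \<open>I\<close>, so maximality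
    among the members above \<open>I\<close> is maximality in \<open>G\<close>.\<close>
  moreover have "J = P" if "J \<in> G" "P \<subseteq> J" for J
    using calculation that by (meson order_trans)
  ultimately show thesis
    by (intro that[of P]) (auto simp: maximal_members_def)
qed

theorem theorem4p3:
  fixes R :: "('a, 'm) ring_scheme" (structure)
    and F S :: "'a set set"
  assumes "ring R"
    and "right_oka_family R F"
    and "\<And>C. \<lbrakk>subset.chain (family_compl R F) C; C \<noteq> {}\<rbrakk>
           \<Longrightarrow> \<exists>U\<in>family_compl R F. \<forall>I\<in>C. I \<subseteq> U"
    and "point_annihilator_set R
           (quot_right_module R ` maximal_members (family_compl R F)) S"
  shows "(\<forall>F\<^sub>0. divisible_family R F\<^sub>0 \<and> semifilter R F\<^sub>0 \<and> F\<^sub>0 \<inter> S \<subseteq> F \<longrightarrow> F\<^sub>0 \<subseteq> F) \<and>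
    (\<forall>J. ideal J R \<and> {I \<in> S. J \<subseteq> I} \<subseteq> F \<longrightarrow> {I \<in> right_ideals R. J \<subseteq> I} \<subseteq> F) \<and>
    (S \<subseteq> F \<longrightarrow> right_ideals R \<subseteq> F)"
proof -
  interpret ring R by fact
  have main: "F\<^sub>0 \<subseteq> F"
    if div: "divisible_family R F\<^sub>0" and semi: "semifilter R F\<^sub>0" and sub: "F\<^sub>0 \<inter> S \<subseteq> F" for F\<^sub>0
  proof (rule ccontr)
    assume "\<not> F\<^sub>0 \<subseteq> F"
    then obtain I where I: "I \<in> F\<^sub>0" "I \<in> family_compl R F"
      using semi by (auto simp: semifilter_def family_compl_def)
    obtain P where P: "P \<in> maximal_members (family_compl R F)" "I \<subseteq> P"
      using maximal_member_above[OF assms(3) I(2)] by blast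
    then have P': "right_ideal P R" "P \<notin> F"
      by (auto simp: maximal_members_def family_compl_def right_ideals_def)
    \<comment> \<open>Upward closure carries membership from \<open>I\<close> to \<open>P\<close>,
      so divisibility can be used for \<open>P\<close>.\<close>
    then have "P \<in> F\<^sub>0"
      using semi I P by (auto simp: semifilter_def right_ideals_def)
    \<comment> \<open>An Oka family contains \<open>R\<close> itself. Hence \<open>P\<close> is
      proper and \<open>R/P\<close> is nonzero, as required for it to have a point annihilator in
      \<open>S\<close>.\<close>
    have "P \<noteq> carrier R"
      using P' assms(2) by (auto simp: right_oka_family_def)
    moreover have "P \<subseteq> carrier R"
      using P'(1) by (simp add: right_ideal_def additive_subgroup.a_subset)
    ultimately have "carrier (quot_right_module R P) \<noteq> {\<zero>\<^bsub>quot_right_module R P\<^esub>}"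
      using quot_right_module_nonzero[OF P'(1)] by auto
    then have "point_annihilators R (quot_right_module R P) \<inter> S \<noteq> {}"
      using assms(4) P by (simp add: point_annihilator_set_def)
    then obtain a where a: "a \<in> carrier R" "a \<notin> P" "right_colon R a P \<in> S"
      by (auto simp: point_annihilators_quot[OF P'(1)])
    moreover have "right_colon R a P \<in> F\<^sub>0"
      using div a \<open>P \<in> F\<^sub>0\<close> by (auto simp: divisible_family_def)
    ultimately show False
      using sub oka_maximal_colon_notin[OF assms(2) P(1)] by blast
  qed
  have above: "{I \<in> right_ideals R. J \<subseteq> I} \<subseteq> F"
    if "ideal J R" "{I \<in> S. J \<subseteq> I} \<subseteq> F" for J
    using main[OF divisible_semifilter_containing[OF that(1)]] that(2) by blast
  \<comment> \<open>The third part is the second one for the zero ideal, which every right ideal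
    contains.\<close>
  have "{\<zero>} \<subseteq> I" if "I \<in> right_ideals R" for I
    using that by (auto simp: right_ideals_def right_ideal_def additive_subgroup.zero_closed)
  then have "right_ideals R \<subseteq> F" if "S \<subseteq> F"
    using above[OF zeroideal] that by blast
  then show ?thesis
    using main above by blast
qed

end
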